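(* There does not exist an isolation scheme for Hamiltonian cycles on graphs of treewidth at most $4$ that uses $o(\log n)$ random bits and polynomially bounded weights (where $n$ is the number of vertices).
   Context: For $\omega\colon U\to\mathbb{N}$, $\omega(X)=\sum_{e\in X}\omega(e)$, and $\omega$ isolates $\mathcal{F}\subseteq 2^U$ if exactly one member of $\mathcal{F}$ attains the minimum weight. $\mathsf{HC}(G)$ denotes the family of edge sets of Hamiltonian cycles of $G$. An isolation scheme for Hamiltonian cycles on a graph class $\mathcal{C}$ is, for every $m$, a list of weight functions $\omega_1,\ldots,\omega_\ell\colon[m]\to\mathbb{N}$ such that for every $G\in\mathcal{C}$ with edges enumerated by $[m]$, at least half of the $\omega_i$ isolate $\mathsf{HC}(G)$; it uses $\log\ell$ random bits and its maximum weight is the largest value of the $\omega_i$. *)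

theory Defs
  imports Complex_Main "HOL-Library.Landau_Symbols"
begin

record 'a ugraph =
  verts :: "'a set"
  edges :: "'a set set"

definition simple_graph :: "'a ugraph \<Rightarrow> bool" where
  "simple_graph G \<longleftrightarrow> finite (verts G) \<and> (\<forall>e\<in>edges G. e \<subseteq> verts G \<and> card e = 2)"

definition cycle_edges :: "'a list \<Rightarrow> 'a set set" where
  "cycle_edges vs = {{vs ! i, vs ! (Suc i mod length vs)} | i. i < length vs}"

definition is_cycle :: "'a ugraph \<Rightarrow> 'a list \<Rightarrow> bool" where
  "is_cycle G vs \<longleftrightarrow>
     3 \<le> length vs \<and> distinct vs \<and> set vs \<subseteq> verts G \<and> cycle_edges vs \<subseteq> edges G"

definition HC :: "'a ugraph \<Rightarrow> 'a set set set" where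
  "HC G = {cycle_edges vs | vs. is_cycle G vs \<and> set vs = verts G}"

text \<open>Connected graphs are required to be nonempty.\<close>

definition connected_graph :: "'a ugraph \<Rightarrow> bool" where
  "connected_graph G \<longleftrightarrow>
     verts G \<noteq> {} \<and> (\<forall>u\<in>verts G. \<forall>v\<in>verts G. (u, v) \<in> {(x, y). {x, y} \<in> edges G}\<^sup>*)"

definition is_tree :: "'a ugraph \<Rightarrow> bool" where
  "is_tree T \<longleftrightarrow> simple_graph T \<and> connected_graph T \<and> (\<nexists>vs. is_cycle T vs)"

definition induced_subgraph :: "'a ugraph \<Rightarrow> 'a set \<Rightarrow> 'a ugraph" where
  "induced_subgraph G X = \<lparr>verts = X, edges = {e \<in> edges G. e \<subseteq> X}\<rparr>"

text \<open>As connected graphs are nonempty, the last clause also says that every vertex lies in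
  some bag.\<close>

definition tree_decomposition :: "'a ugraph \<Rightarrow> 'b ugraph \<Rightarrow> ('b \<Rightarrow> 'a set) \<Rightarrow> bool" where
  "tree_decomposition G T B \<longleftrightarrow>
     is_tree T \<and>
     (\<forall>t\<in>verts T. B t \<subseteq> verts G) \<and>
     (\<forall>e\<in>edges G. \<exists>t\<in>verts T. e \<subseteq> B t) \<and>
     (\<forall>v\<in>verts G. connected_graph (induced_subgraph T {t \<in> verts T. v \<in> B t}))"

definition decomposition_width :: "'b ugraph \<Rightarrow> ('b \<Rightarrow> 'a set) \<Rightarrow> nat" where
  "decomposition_width T B = Max ((\<lambda>t. card (B t)) ` verts T) - 1"

text \<open>Decomposition trees are finite, so nodes of type \<^typ>\<open>nat\<close> lose no generality. The graph
  without vertices gets treewidth 0 instead of -1.\<close>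

definition treewidth :: "'a ugraph \<Rightarrow> nat" where
  "treewidth G =
     (LEAST w. \<exists>(T :: nat ugraph) B. tree_decomposition G T B \<and> decomposition_width T B = w)"

text \<open>The class of graphs of treewidth at most \<open>k\<close>. Every finite graph is isomorphic to one with
  natural numbers as vertices.\<close>

definition treewidth_class :: "nat \<Rightarrow> nat ugraph set" where
  "treewidth_class k = {G. simple_graph G \<and> treewidth G \<le> k}"

definition isolates :: "('e \<Rightarrow> nat) \<Rightarrow> 'e set set \<Rightarrow> bool" where
  "isolates \<omega> F \<longleftrightarrow> (\<exists>!X. is_arg_min (sum \<omega>) (\<lambda>Y. Y \<in> F) X)"

text \<open>A scheme maps \<open>m\<close> to the list of its weight functions on \<open>{1..m}\<close>; values outside \<open>{1..m}\<close>
  are never used. The list must be nonempty: an empty one would satisfy the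
  "at least half" condition vacuously. An enumeration of the edges is a bijection \<open>\<phi>\<close>
  onto \<open>{1..m}\<close>, along which weight functions are pulled back to the edges of \<open>G\<close>. Isolation is
  demanded only of graphs that have a Hamiltonian cycle, since no weight function isolates
  the empty family.\<close>

type_synonym scheme = "nat \<Rightarrow> (nat \<Rightarrow> nat) list"

definition HC_isolation_scheme :: "'a ugraph set \<Rightarrow> scheme \<Rightarrow> bool" where
  "HC_isolation_scheme C S \<longleftrightarrow>
     (\<forall>m. S m \<noteq> [] \<and>
       (\<forall>G\<in>C. \<forall>\<phi>. bij_betw \<phi> (edges G) {1..m} \<and> HC G \<noteq> {} \<longrightarrow>
          real (length (filter (\<lambda>\<omega>. isolates (\<omega> \<circ> \<phi>) (HC G)) (S m))) \<ge> real (length (S m)) / 2))"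

definition random_bits :: "scheme \<Rightarrow> nat \<Rightarrow> real" where
  "random_bits S m = log 2 (real (length (S m)))"

text \<open>For \<open>m = 0\<close> this is \<^prop>\<open>Sup {} = (0 :: nat)\<close>.\<close>

definition max_weight :: "scheme \<Rightarrow> nat \<Rightarrow> nat" where
  "max_weight S m = Sup {\<omega> e | \<omega> e. \<omega> \<in> set (S m) \<and> e \<in> {1..m}}"

text \<open>Schemes are indexed by the number \<open>m\<close> of edges, whereas their resources are measured in the
  number \<open>n\<close> of vertices: the bound at \<open>n\<close> has to hold for every \<open>m\<close> for which the class contains
  a graph with \<open>n\<close> vertices and \<open>m\<close> edges.\<close>

definition uses_random_bits :: "'a ugraph set \<Rightarrow> scheme \<Rightarrow> (nat \<Rightarrow> real) \<Rightarrow> bool" where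
  "uses_random_bits C S b \<longleftrightarrow>
     (\<forall>G\<in>C. random_bits S (card (edges G)) \<le> b (card (verts G)))"

definition uses_weights :: "'a ugraph set \<Rightarrow> scheme \<Rightarrow> (nat \<Rightarrow> real) \<Rightarrow> bool" where
  "uses_weights C S w \<longleftrightarrow>
     (\<forall>G\<in>C. real (max_weight S (card (edges G))) \<le> w (card (verts G)))"

end

(* A ring of levels, each a single vertex or a path of three vertices (a triple), has the property
  that around a maximal run of consecutive triples (a gadget) every Hamiltonian cycle uses exactly
  one of two disjoint edge sets of equal size, the halves, and reflecting the gadget exchanges them.
  So a weight function that gives the two halves of some gadget the same weight does not isolate.
  As the enumeration of the edges is arbitrary, it suffices to find, for each weight function, two
  disjoint sets of edge numbers with equal size and equal weight, and to enumerate one gadget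
  accordingly: for polynomially bounded weights the pigeonhole principle provides such sets of
  bounded size. With o(log n) random bits there are few enough weight functions to defeat all of
  them in one ring, whose treewidth is at most 4. *)

theory Submission
  imports Defs "HOL-Library.Disjoint_Sets"
begin

section \<open>Hamiltonian cycles\<close>

text \<open>The centre of a triple has degree two, so both rungs lie on every Hamiltonian cycle and
  each port keeps exactly one of its links: the cycle changes sides at every triple. One bit, chosen
  where the cycle enters the run of triples, therefore fixes all links of the gadget, and the halves
  are the two resulting zigzags. The single vertices at both ends make the bit independent of
  everything outside. The treewidth comes from putting one vertex into every bag, which cuts the
  ring open; two neighbouring levels add four ports, so bags have five vertices. For weights of
  order \<open>M ^ c\<close>, sums over \<open>r\<close>-sets take O(\<open>M ^ c\<close>) values,
  while there are at least \<open>(M / r) ^ r\<close> such sets; \<open>r = c + 1\<close> is enough,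
  whatever the number of weight functions. A gadget thus costs a bounded number of edges, and o(log
  n) bits leave at most about the square root of \<open>m\<close> functions.\<close>

lemma cycle_edges_map: "cycle_edges (map f vs) = (`) f ` cycle_edges vs"
proof -
  have "{map f vs ! i, map f vs ! (Suc i mod length vs)} = f ` {vs ! i, vs ! (Suc i mod length vs)}"
    if "i < length vs" for i
  proof -
    have "Suc i mod length vs < length vs"
      using that by (intro mod_less_divisor) auto
    with that show ?thesis by simp
  qed
  then show ?thesis
    unfolding cycle_edges_def setcompr_eq_image image_image by (auto intro!: image_cong)
qed

lemma HC_image:
  assumes X: "X \<in> HC G" and inj: "inj_on f (verts G)" and V: "f ` verts G = verts G"
    and E: "\<And>e. e \<in> edges G \<Longrightarrow> f ` e \<in> edges G"
  shows "(`) f ` X \<in> HC G"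
proof -
  from X obtain vs where vs: "X = cycle_edges vs" "is_cycle G vs" "set vs = verts G"
    by (auto simp: HC_def)
  have "is_cycle G (map f vs)"
    using vs inj E V unfolding is_cycle_def cycle_edges_map by (auto simp: distinct_map)
  then show ?thesis
    using vs V unfolding HC_def by (auto simp flip: cycle_edges_map intro!: exI[of _ "map f vs"])
qed

lemma HC_subset: "X \<in> HC G \<Longrightarrow> X \<subseteq> edges G"
  by (auto simp: HC_def is_cycle_def)

text \<open>The edges that a Hamiltonian cycle must use inside a gadget all follow from this local
  condition.\<close>

lemma HC_degree:
  assumes "X \<in> HC G" "v \<in> verts G"
  shows "card {e \<in> X. v \<in> e} = 2"
proof -
  from assms obtain vs where vs: "X = cycle_edges vs" "3 \<le> length vs" "distinct vs" "v \<in> set vs"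
    by (auto simp: HC_def is_cycle_def)
  define n where "n = length vs"
  from vs(4) obtain i where i: "i < n" "v = vs ! i" by (auto simp: in_set_conv_nth n_def)
  define p where "p = (if i = 0 then n - 1 else i - 1)"
  define q where "q = (if i = n - 1 then 0 else Suc i)"
  have n: "3 \<le> n" using vs n_def by simp
  have suc: "Suc j mod n = (if j = n - 1 then 0 else Suc j)" if "j < n" for j
    using that n by auto
  have pq: "p < n" "q < n" "p \<noteq> q" "p \<noteq> i" "q \<noteq> i" "Suc i mod n = q" "Suc p mod n = i"
    using i n suc[of i] suc[of p] by (auto simp: p_def q_def split: if_splits)
  have nth: "vs ! a = vs ! b \<longleftrightarrow> a = b" if "a < n" "b < n" for a b
    using that vs(3) by (simp add: n_def nth_eq_iff_index_eq)
  have iff: "j = i \<or> j = p" if "j < n" "v \<in> {vs ! j, vs ! (Suc j mod n)}" for j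
  proof -
    have "Suc j mod n < n" using n by simp
    with that nth i have "i = j \<or> i = Suc j mod n" by auto
    with that suc[of j] show ?thesis by (auto simp: p_def split: if_splits)
  qed
  have "{e \<in> X. v \<in> e} = {{vs ! i, vs ! q}, {vs ! p, vs ! i}}"
  proof (intro equalityI subsetI)
    fix e assume "e \<in> {e \<in> X. v \<in> e}"
    then obtain j where j: "j < n" "e = {vs ! j, vs ! (Suc j mod n)}" "v \<in> e"
      by (auto simp: vs(1) cycle_edges_def n_def)
    with iff[of j] have "j = i \<or> j = p" by blast
    then show "e \<in> {{vs ! i, vs ! q}, {vs ! p, vs ! i}}"
      using j(2) pq(6,7) by auto
  next
    fix e assume "e \<in> {{vs ! i, vs ! q}, {vs ! p, vs ! i}}"
    then have "e = {vs ! i, vs ! (Suc i mod n)} \<or> e = {vs ! p, vs ! (Suc p mod n)}"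
      using pq by auto
    moreover have "v \<in> e"
      using \<open>e \<in> {{vs ! i, vs ! q}, {vs ! p, vs ! i}}\<close> i by auto
    ultimately show "e \<in> {e \<in> X. v \<in> e}"
      using i(1) pq(1) unfolding vs(1) cycle_edges_def n_def by blast
  qed
  \<comment> \<open>Length at least three keeps the predecessor \<open>p\<close> and the successor
    \<open>q\<close> apart, so the two edges at \<open>v\<close> differ.\<close>
  moreover have "{vs ! i, vs ! q} \<noteq> {vs ! p, vs ! i}"
    using nth[of p q] nth[of p i] nth[of q i] i pq by (auto simp: doubleton_eq_iff)
  ultimately show ?thesis by simp
qed

lemma card_two_subset_pair:
  assumes "card Y = 2" "Y \<subseteq> {a, b}"
  shows "a \<in> Y \<and> b \<in> Y"
proof -
  have "card {a, b} \<le> 2" by (simp add: card_insert_if)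
  then have "Y = {a, b}" using assms by (intro card_seteq) auto
  then show ?thesis by simp
qed

text \<open>Meant for a vertex with three edges, one of which is forced: degree two leaves room for
  exactly one of the others.\<close>

lemma card_two_subset_triple:
  assumes "card Y = 2" "Y \<subseteq> {a, b, c}" "a \<in> Y" "a \<noteq> b" "a \<noteq> c" "b \<noteq> c"
  shows "b \<in> Y \<longleftrightarrow> c \<notin> Y"
proof -
  have "card (Y - {a}) = 1" using assms by simp
  then obtain d where d: "Y - {a} = {d}" by (auto simp: card_1_singleton_iff)
  with assms(2) have "d = b \<or> d = c" by auto
  moreover from d assms(3) have "Y = {a, d}" by blast
  ultimately show ?thesis using assms(4-6) by blast
qed

text \<open>A minimum would have a twin of equal weight, which is a minimum as well.\<close>

lemma not_isolates_if_swap: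
  assumes "\<And>X. X \<in> F \<Longrightarrow> \<exists>Y\<in>F. Y \<noteq> X \<and> sum \<omega> Y = sum \<omega> X"
  shows "\<not> isolates \<omega> F"
proof
  assume "isolates \<omega> F"
  then obtain X where X: "is_arg_min (sum \<omega>) (\<lambda>Y. Y \<in> F) X"
    and uniq: "\<And>Y. is_arg_min (sum \<omega>) (\<lambda>Y. Y \<in> F) Y \<Longrightarrow> Y = X"
    unfolding isolates_def by blast
  from X have "X \<in> F" by (simp add: is_arg_min_def)
  with assms obtain Y where "Y \<in> F" "Y \<noteq> X" "sum \<omega> Y = sum \<omega> X" by blast
  moreover from this X have "is_arg_min (sum \<omega>) (\<lambda>Y. Y \<in> F) Y"
    by (simp add: is_arg_min_def)
  ultimately show False using uniq by blast
qed

lemma cycle_edges_subset_if_successively: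
  assumes "successively (\<lambda>x y. {x, y} \<in> E) vs" "vs \<noteq> []" "{last vs, hd vs} \<in> E"
  shows "cycle_edges vs \<subseteq> E"
proof
  fix e assume "e \<in> cycle_edges vs"
  then obtain i where i: "i < length vs" "e = {vs ! i, vs ! (Suc i mod length vs)}"
    by (auto simp: cycle_edges_def)
  show "e \<in> E"
  proof (cases "Suc i < length vs")
    case True
    then show ?thesis using assms(1) i by (simp add: successively_conv_nth)
  next
    case False
    with i have "Suc i = length vs" by simp
    with i(2) have "e = {vs ! (length vs - 1), vs ! 0}" by (metis diff_Suc_1 mod_self)
    with assms(2,3) show ?thesis by (simp add: last_conv_nth hd_conv_nth)
  qed
qed

section \<open>Path decompositions\<close>

definition path_graph :: "nat \<Rightarrow> nat ugraph" where
  "path_graph k = \<lparr>verts = {..k}, edges = {{i, Suc i} | i. i < k}\<rparr>"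

lemma connected_induced_path_graph:
  assumes "X \<noteq> {}" "X \<subseteq> {..k}"
    and conv: "\<And>a b c. a \<in> X \<Longrightarrow> c \<in> X \<Longrightarrow> a \<le> b \<Longrightarrow> b \<le> c \<Longrightarrow> b \<in> X"
  shows "connected_graph (induced_subgraph (path_graph k) X)"
proof -
  let ?R = "{(x, y). {x, y} \<in> edges (induced_subgraph (path_graph k) X)}"
  have up: "c \<in> X \<longrightarrow> (a, c) \<in> ?R\<^sup>*" if "a \<le> c" "a \<in> X" for a c
    using that(1)
  proof (induction c rule: dec_induct)
    case base
    then show ?case by simp
  next
    case (step c)
    show ?case
    proof
      assume c: "Suc c \<in> X"
      with step that conv have "c \<in> X" by (meson le_SucI order_refl)
      moreover from c assms(2) have "c < k" by auto
      ultimately have "(c, Suc c) \<in> ?R"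
        using c by (auto simp: induced_subgraph_def path_graph_def)
      with step \<open>c \<in> X\<close> show "(a, Suc c) \<in> ?R\<^sup>*" by (meson rtrancl.rtrancl_into_rtrancl)
    qed
  qed
  have "sym ?R" by (auto simp: sym_def insert_commute)
  then have "sym (?R\<^sup>*)" by (rule sym_rtrancl)
  with up have "(a, c) \<in> ?R\<^sup>*" if "a \<in> X" "c \<in> X" for a c
    using that by (metis nat_le_linear symD)
  then show ?thesis
    using assms(1) unfolding connected_graph_def by (simp add: induced_subgraph_def)
qed

lemma is_tree_path_graph: "is_tree (path_graph k)"
proof -
  have "simple_graph (path_graph k)"
    by (auto simp: simple_graph_def path_graph_def)
  moreover have "induced_subgraph (path_graph k) {..k} = path_graph k"
    by (auto simp: induced_subgraph_def path_graph_def)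
  then have "connected_graph (path_graph k)"
    using connected_induced_path_graph[of "{..k}" k] by auto
  moreover have "\<not> is_cycle (path_graph k) vs" for vs
  proof
    assume cyc: "is_cycle (path_graph k) vs"
    \<comment> \<open>The supposed cycle is a Hamiltonian cycle of the graph formed by its own
      vertices and edges, so \<open>HC_degree\<close> applies. Its largest node has no larger
      neighbour and hence degree at most one.\<close>
    define G where "G = \<lparr>verts = set vs, edges = cycle_edges vs\<rparr>"
    have HC: "cycle_edges vs \<in> HC G"
      using cyc by (auto simp: HC_def G_def is_cycle_def)
    define v where "v = Max (set vs)"
    have "vs \<noteq> []" using cyc by (auto simp: is_cycle_def)
    then have v: "v \<in> set vs" by (auto simp: v_def)
    have "{e \<in> cycle_edges vs. v \<in> e} \<subseteq> {{v - 1, v}}"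
    proof
      fix e assume e: "e \<in> {e \<in> cycle_edges vs. v \<in> e}"
      then obtain i where i: "e = {i, Suc i}"
        using cyc by (auto simp: is_cycle_def path_graph_def)
      have "e \<subseteq> set vs"
      proof -
        from e obtain j where "j < length vs" "e = {vs ! j, vs ! (Suc j mod length vs)}"
          by (auto simp: cycle_edges_def)
        moreover from this have "Suc j mod length vs < length vs"
          by (intro mod_less_divisor) auto
        ultimately show ?thesis by auto
      qed
      with i have "Suc i \<le> v" by (auto simp: v_def)
      with i e show "e \<in> {{v - 1, v}}" by auto
    qed
    then have "card {e \<in> cycle_edges vs. v \<in> e} \<le> card {{v - 1, v}}"
      by (intro card_mono) auto
    with HC_degree[OF HC, of v] v show False by (simp add: G_def)
  qed
  ultimately show ?thesis unfolding is_tree_def by blast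
qed

section \<open>Rings of levels\<close>

text \<open>Level \<open>j\<close> is the path on \<open>3 * j + 1\<close>, \<open>3 * j\<close>, \<open>3 * j + 2\<close> if \<open>j \<in> Q\<close>, and the single vertex
  \<open>3 * j\<close> otherwise, which then serves as port on both sides.\<close>

definition port :: "nat set \<Rightarrow> bool \<Rightarrow> nat \<Rightarrow> nat" where
  "port Q s j = (if j \<in> Q then 3 * j + (if s then 1 else 2) else 3 * j)"

text \<open>Between two single levels the links of both sides coincide, so such levels are joined by
  one edge, while a triple has two links to each neighbour.\<close>

definition link :: "nat set \<Rightarrow> bool \<Rightarrow> nat \<Rightarrow> nat set" where
  "link Q s j = {port Q s j, port Q s (Suc j)}"

definition rung :: "nat set \<Rightarrow> bool \<Rightarrow> nat \<Rightarrow> nat set" where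
  "rung Q s j = {3 * j, port Q s j}"

text \<open>Kept apart from the closing edge: lengthening the ring replaces that edge, whereas the
  core only grows.\<close>

definition ring_core :: "nat \<Rightarrow> nat set \<Rightarrow> nat set set" where
  "ring_core n Q = case_prod (link Q) ` (UNIV \<times> {..<n}) \<union> case_prod (rung Q) ` (UNIV \<times> Q)"

definition ring_graph :: "nat \<Rightarrow> nat set \<Rightarrow> nat ugraph" where
  "ring_graph n Q =
     \<lparr>verts = (\<lambda>j. 3 * j) ` {..n} \<union> case_prod (port Q) ` (UNIV \<times> Q),
      edges = insert {3 * n, 0} (ring_core n Q)\<rparr>"

lemma port_div [simp]: "port Q s j div 3 = j"
  by (auto simp: port_def)

lemma port_eq_iff: "port Q s j = port Q s' j' \<longleftrightarrow> j = j' \<and> (j \<in> Q \<longrightarrow> s = s')"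
proof
  assume eq: "port Q s j = port Q s' j'"
  then have "j = j'" by (metis port_div)
  with eq show "j = j' \<and> (j \<in> Q \<longrightarrow> s = s')" by (auto simp: port_def split: if_splits)
qed (auto simp: port_def)

lemma port_eq_triple_iff: "port Q s j = 3 * j' \<longleftrightarrow> j = j' \<and> j \<notin> Q"
proof
  assume eq: "port Q s j = 3 * j'"
  then have "j = j'" by (metis port_div nonzero_mult_div_cancel_left zero_neq_numeral)
  with eq show "j = j' \<and> j \<notin> Q" by (auto simp: port_def split: if_splits)
qed (auto simp: port_def)

lemma port_single: "j \<notin> Q \<Longrightarrow> port Q s j = 3 * j"
  by (simp add: port_def)

lemma link_eq_iff:
  "link Q s j = link Q s' j' \<longleftrightarrow> j = j' \<and> (j \<in> Q \<or> Suc j \<in> Q \<longrightarrow> s = s')"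
  by (auto simp: link_def doubleton_eq_iff port_eq_iff)

lemma rung_neq_link: "rung Q s j \<noteq> link Q s' j'"
  by (auto simp: link_def rung_def doubleton_eq_iff port_eq_iff eq_commute[of "3 * j"] port_eq_triple_iff)

lemma verts_ring_graph_iff:
  "v \<in> verts (ring_graph n Q) \<longleftrightarrow> (\<exists>j\<le>n. v = 3 * j) \<or> (\<exists>s. \<exists>j\<in>Q. v = port Q s j)"
  by (auto simp: ring_graph_def image_iff)

lemma edges_ring_graph_iff:
  "e \<in> edges (ring_graph n Q) \<longleftrightarrow>
     e = {3 * n, 0} \<or> (\<exists>s. \<exists>j<n. e = link Q s j) \<or> (\<exists>s. \<exists>j\<in>Q. e = rung Q s j)"
  by (auto simp: ring_graph_def ring_core_def image_iff)

text \<open>With level \<open>n\<close> single, a further single level can be appended there. Three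
  levels keep the closing edge from coinciding with a link.\<close>

locale ring =
  fixes n :: nat and Q :: "nat set"
  assumes n: "2 \<le> n" and Q: "Q \<subseteq> {0<..<n}"
begin

abbreviation "G \<equiv> ring_graph n Q"

section \<open>Rings and their treewidth\<close>

lemma finite_Q: "finite Q"
  using Q by (rule finite_subset) simp

lemma finite_edges: "finite (edges G)"
  using finite_Q by (simp add: ring_graph_def ring_core_def)

lemma zero_notin: "0 \<notin> Q" and last_notin: "n \<notin> Q"
  using Q by auto

lemma port_in_verts: "j \<le> n \<Longrightarrow> port Q s j \<in> verts G"
  unfolding verts_ring_graph_iff by (cases "j \<in> Q") (auto simp: port_def)

lemma simple_ring_graph: "simple_graph G"
  unfolding simple_graph_def
proof (intro conjI ballI)
  show "finite (verts G)" using finite_Q by (simp add: ring_graph_def)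
next
  fix e assume "e \<in> edges G"
  then consider "e = {3 * n, 0}" | s j where "j < n" "e = link Q s j" | s j where "j \<in> Q" "e = rung Q s j"
    unfolding edges_ring_graph_iff by blast
  then have "e \<subseteq> verts G \<and> card e = 2"
  proof cases
    case 1
    then show ?thesis using n by (auto simp: verts_ring_graph_iff)
  next
    case 2
    then show ?thesis
      using port_in_verts by (auto simp: link_def card_insert_if port_eq_iff)
  next
    case 3
    then have "j < n" using Q by auto
    with 3 show ?thesis
      using port_in_verts
      by (auto simp: rung_def card_insert_if eq_commute[of "3 * j"] port_eq_triple_iff)
        (auto simp: verts_ring_graph_iff)
  qed
  then show "e \<subseteq> verts G" "card e = 2" by auto
qed

text \<open>An even bag covers the rungs of level \<open>j\<close>, an odd bag the links between
  \<open>j\<close> and \<open>Suc j\<close>; vertex \<open>0\<close> in every bag takes care of the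
  closing edge. Lists make the size bound a matter of length.\<close>

definition bag :: "nat \<Rightarrow> nat list" where
  "bag t = (let j = t div 2 in
     if even t then [0, 3 * j, port Q True j, port Q False j]
     else [0, port Q True j, port Q False j, port Q True (Suc j), port Q False (Suc j)])"

lemma bag_even: "bag (2 * j) = [0, 3 * j, port Q True j, port Q False j]"
  and bag_odd: "bag (Suc (2 * j)) =
    [0, port Q True j, port Q False j, port Q True (Suc j), port Q False (Suc j)]"
  by (simp_all add: bag_def)

lemma bag_port: "{t. t \<le> 2 * n \<and> port Q s j \<in> set (bag t)} = {2 * j - 1..Suc (2 * j)} \<inter> {..2 * n}"
  if "port Q s j \<noteq> 0"
proof -
  have "j \<noteq> 0"
    using that zero_notin by (cases "j = 0") (auto simp: port_def)
  have *: "port Q s j \<in> set (bag t) \<longleftrightarrow> 2 * j - 1 \<le> t \<and> t \<le> Suc (2 * j)" for t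
  proof (cases "even t")
    case True
    then obtain i where "t = 2 * i" by blast
    with that \<open>j \<noteq> 0\<close> show ?thesis
      by (cases s) (auto simp: bag_even port_eq_iff port_eq_triple_iff)
  next
    case False
    then obtain i where "t = Suc (2 * i)" by (metis oddE Suc_eq_plus1)
    with that \<open>j \<noteq> 0\<close> show ?thesis
      by (cases s) (auto simp: bag_odd port_eq_iff)
  qed
  show ?thesis
    by (simp only: * set_eq_iff mem_Collect_eq Int_iff atLeastAtMost_iff atMost_iff conj_ac simp_thms)
qed

lemma bag_rung_center: "{t. t \<le> 2 * n \<and> 3 * j \<in> set (bag t)} = {2 * j}" if "j \<in> Q"
proof -
  have "j \<noteq> 0" "j < n"
    using that Q by auto
  have "3 * j \<in> set (bag t) \<longleftrightarrow> t = 2 * j" for t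
  proof (cases "even t")
    case True
    then obtain i where "t = 2 * i" by blast
    with that \<open>j \<noteq> 0\<close> show ?thesis
      by (auto simp: bag_even eq_commute[of "3 * j"] port_eq_triple_iff)
  next
    case False
    then obtain i where "t = Suc (2 * i)" by (metis oddE Suc_eq_plus1)
    with that \<open>j \<noteq> 0\<close> show ?thesis
      by (auto simp: bag_odd eq_commute[of "3 * j"] port_eq_triple_iff) presburger+
  qed
  with \<open>j < n\<close> show ?thesis by auto
qed

lemma tree_decomposition_bag:
  "tree_decomposition G (path_graph (2 * n)) (\<lambda>t. set (bag t) \<inter> verts G)"
  unfolding tree_decomposition_def
proof (intro conjI ballI is_tree_path_graph)
  fix e assume e: "e \<in> edges G"
  then have sub: "e \<subseteq> verts G" using simple_ring_graph by (simp add: simple_graph_def)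
  from e have "\<exists>t\<le>2 * n. e \<subseteq> set (bag t)"
    unfolding edges_ring_graph_iff
  proof (elim disjE exE bexE conjE)
    assume "e = {3 * n, 0}"
    then show ?thesis by (intro exI[of _ "2 * n"]) (auto simp: bag_even)
  next
    fix s j assume "j < n" "e = link Q s j"
    then show ?thesis
      by (intro exI[of _ "Suc (2 * j)"]) (cases s; auto simp: bag_odd link_def)
  next
    fix s j assume "j \<in> Q" "e = rung Q s j"
    then show ?thesis
      using Q by (intro exI[of _ "2 * j"]) (cases s; auto simp: bag_even rung_def)
  qed
  with sub show "\<exists>t\<in>verts (path_graph (2 * n)). e \<subseteq> set (bag t) \<inter> verts G"
    by (auto simp: path_graph_def)
next
  fix v assume v: "v \<in> verts G"
  define X where "X = {t. t \<le> 2 * n \<and> v \<in> set (bag t)}"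
  have eq: "{t \<in> verts (path_graph (2 * n)). v \<in> set (bag t) \<inter> verts G} = X"
    using v by (auto simp: path_graph_def X_def)
  have "\<exists>a b. a \<le> b \<and> a \<le> 2 * n \<and> X = {a..b} \<inter> {..2 * n}"
  proof (cases "v = 0")
    case True
    then have "X = {0..2 * n} \<inter> {..2 * n}" by (auto simp: X_def bag_def Let_def)
    then show ?thesis by blast
  next
    case False
    from v consider j where "j \<in> Q" "v = 3 * j" | s j where "j \<le> n" "v = port Q s j"
      unfolding verts_ring_graph_iff using Q by (metis port_single greaterThanLessThan_iff less_imp_le subsetD)
    then show ?thesis
    proof cases
      case 1
      then have "X = {2 * j..2 * j} \<inter> {..2 * n}" "2 * j \<le> 2 * n"
        using Q bag_rung_center[of j] by (auto simp: X_def)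
      then show ?thesis by blast
    next
      case 2
      then have "X = {2 * j - 1..Suc (2 * j)} \<inter> {..2 * n}"
        using False bag_port[of s j] by (simp add: X_def)
      moreover have "2 * j - 1 \<le> Suc (2 * j)" "2 * j - 1 \<le> 2 * n" using 2 by auto
      ultimately show ?thesis by blast
    qed
  qed
  then obtain a b where "a \<le> b" "a \<le> 2 * n" "X = {a..b} \<inter> {..2 * n}" by blast
  then have "connected_graph (induced_subgraph (path_graph (2 * n)) X)"
    by (intro connected_induced_path_graph) auto
  then show "connected_graph (induced_subgraph (path_graph (2 * n))
      {t \<in> verts (path_graph (2 * n)). v \<in> set (bag t) \<inter> verts G})"
    unfolding eq .
qed auto

lemma ring_graph_in_treewidth_class: "G \<in> treewidth_class 4"
proof -
  let ?B = "\<lambda>t. set (bag t) \<inter> verts G"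
  have "card (?B t) \<le> 5" for t
  proof -
    have "card (?B t) \<le> card (set (bag t))" by (intro card_mono) auto
    also have "\<dots> \<le> length (bag t)" by (rule card_length)
    also have "\<dots> \<le> 5" by (simp add: bag_def Let_def)
    finally show ?thesis .
  qed
  then have "decomposition_width (path_graph (2 * n)) ?B \<le> 4"
    unfolding decomposition_width_def
    by (simp add: le_diff_conv path_graph_def)
  moreover have "treewidth G \<le> decomposition_width (path_graph (2 * n)) ?B"
    unfolding treewidth_def using tree_decomposition_bag by (intro Least_le) blast
  ultimately show ?thesis
    using simple_ring_graph by (simp add: treewidth_class_def)
qed

end

section \<open>The number of edges of a ring\<close>

lemma card_edges_ring_graph_Suc:
  assumes "ring n Q"
  shows "card (edges (ring_graph (Suc n) Q)) = Suc (card (edges (ring_graph n Q)))"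
proof -
  interpret ring n Q by fact
  have Suc: "Suc n \<notin> Q" using Q by auto
  \<comment> \<open>The link to the appended vertex \<open>3 * Suc n\<close> takes the place of the
    old closing edge; the new closing edge is the one gained.\<close>
  have core: "ring_core (Suc n) Q = insert {3 * n, 3 * Suc n} (ring_core n Q)"
    using last_notin Suc
    by (auto simp: ring_core_def lessThan_Suc image_iff link_def port_single)
  have bound: "v \<le> 3 * n" if "e \<in> ring_core n Q" "v \<in> e" for e v
  proof -
    have "port Q s j \<le> 3 * n" if "j \<le> n" for s j
    proof (cases "j = n")
      case True
      then show ?thesis using last_notin by (simp add: port_single)
    next
      case False
      then have "port Q s j \<le> 3 * j + 2" "j < n" using that by (auto simp: port_def)
      then show ?thesis by linarith
    qed
    note le = this
    from that(1) consider s j where "j < n" "e = link Q s j" | s j where "j \<in> Q" "e = rung Q s j"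
      unfolding ring_core_def by auto
    then show ?thesis
    proof cases
      case 1
      then show ?thesis using that(2) le[of j] le[of "Suc j"] by (auto simp: link_def)
    next
      case 2
      then have "j \<le> n" using Q by auto
      then show ?thesis using that(2) 2 le[of j] by (auto simp: rung_def)
    qed
  qed
  have fin: "finite (ring_core n Q)" using finite_Q by (simp add: ring_core_def)
  have closing: "{3 * n, 0} \<notin> ring_core n Q"
  proof
    assume "{3 * n, 0} \<in> ring_core n Q"
    then consider s j where "j < n" "{3 * n, 0} = link Q s j" | s j where "j \<in> Q" "{3 * n, 0} = rung Q s j"
      unfolding ring_core_def by auto
    then show False
    proof cases
      case 1
      \<comment> \<open>Division by 3 sends a vertex to its level, so a link becomes a pair of
        consecutive levels, which \<open>n\<close> and \<open>0\<close> are not.\<close>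
      then have "(\<lambda>v. v div 3) ` {3 * n, 0} = {j, Suc j}" by (simp add: link_def)
      then show False using n by (auto simp: doubleton_eq_iff)
    next
      case 2
      then have "(\<lambda>v. v div 3) ` {3 * n, 0} = {j}" by (simp add: rung_def)
      then show False using n by (auto simp: doubleton_eq_iff)
    qed
  qed
  have "{3 * n, 3 * Suc n} \<notin> ring_core n Q" "{3 * Suc n, 0} \<notin> ring_core n Q"
    using bound by fastforce+
  moreover have "{3 * Suc n, 0} \<noteq> {3 * n, 3 * Suc n}" using n by (auto simp: doubleton_eq_iff)
  ultimately show ?thesis
    using fin closing by (simp add: ring_graph_def core)
qed

text \<open>Padding with single levels gains one edge at a time, so every large enough
  \<open>m\<close> can be hit exactly.\<close>

lemma card_edges_ring_graph_add:
  assumes "ring n Q"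
  shows "card (edges (ring_graph (n + d) Q)) = card (edges (ring_graph n Q)) + d"
proof (induction d)
  case (Suc d)
  have "ring (n + d) Q" using assms by (auto simp: ring_def)
  with Suc card_edges_ring_graph_Suc show ?case by simp
qed simp

lemma (in ring) card_edges_le: "card (edges G) \<le> 4 * n"
proof -
  have "card Q \<le> card {0<..<n}" using Q by (intro card_mono) auto
  then have Q': "card Q \<le> n - 1" by simp
  have "card (edges G) \<le> Suc (card (ring_core n Q))"
    using finite_Q by (simp add: ring_graph_def ring_core_def card_insert_if)
  also have "card (ring_core n Q) \<le> card ((UNIV :: bool set) \<times> {..<n}) + card ((UNIV :: bool set) \<times> Q)"
    unfolding ring_core_def using finite_Q
    by (intro order.trans[OF card_Un_le] add_mono card_image_le) auto
  also have "\<dots> \<le> 2 * n + 2 * (n - 1)" using Q' by (simp add: card_cartesian_product)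
  finally show ?thesis using n by simp
qed

text \<open>Without triples the ring is a plain cycle, on which the resource bounds will be
  evaluated.\<close>

lemma card_edges_cycle: "2 \<le> n \<Longrightarrow> card (edges (ring_graph n {})) = Suc n"
proof -
  assume n: "2 \<le> n"
  have r: "ring 2 {}" by unfold_locales auto
  have "edges (ring_graph 2 {}) = {{6, 0}, {0, 3}, {3, 6}}"
    by (auto simp: ring_graph_def ring_core_def link_def port_def numeral_2_eq_2 lessThan_Suc image_iff)
  then have "card (edges (ring_graph 2 {})) = 3"
    by (simp add: card_insert_if doubleton_eq_iff)
  with card_edges_ring_graph_add[OF r, of "n - 2"] n show ?thesis
    by (metis add.commute add_Suc_right le_add_diff_inverse2 numeral_2_eq_2 numeral_3_eq_3 plus_1_eq_Suc)
qed

lemma card_verts_cycle: "card (verts (ring_graph n {})) = Suc n"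
proof -
  have "verts (ring_graph n {}) = (\<lambda>j. 3 * j) ` {..n}" by (simp add: ring_graph_def)
  then show ?thesis by (simp add: card_image inj_on_def)
qed

section \<open>A Hamiltonian cycle of the ring\<close>

context ring begin

text \<open>The Hamiltonian cycle enters a level at the port of the side \<open>odd j\<close> and leaves it at the
  other port.\<close>

definition level :: "nat \<Rightarrow> nat list" where
  "level j = (if j \<in> Q then [port Q (odd j) j, 3 * j, port Q (even j) j] else [3 * j])"

fun levels :: "nat \<Rightarrow> nat list" where
  "levels 0 = level 0"
| "levels (Suc j) = levels j @ level (Suc j)"

lemma level_simps: "level j \<noteq> []" "hd (level j) = port Q (odd j) j" "last (level j) = port Q (even j) j"
  by (auto simp: level_def port_single)

lemma last_levels: "levels k \<noteq> []" "last (levels k) = port Q (even k) k"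
  by (cases k; simp add: level_simps)+

lemma hd_levels: "hd (levels k) = 0"
  using zero_notin by (induction k) (auto simp: last_levels hd_append level_simps port_def)

lemma set_level: "v \<in> set (level j) \<longleftrightarrow> v = 3 * j \<or> (\<exists>s. v = port Q s j)"
  by (cases "even j") (auto simp: level_def port_single ex_bool_eq)

lemma set_levels: "v \<in> set (levels k) \<longleftrightarrow> (\<exists>j\<le>k. v \<in> set (level j))"
  by (induction k) (auto simp: le_Suc_eq)

lemma distinct_levels: "distinct (levels k)"
proof (induction k)
  case 0
  then show ?case using zero_notin by (simp add: level_def)
next
  case (Suc k)
  have "v div 3 = j" if "v \<in> set (level j)" for v j
    using that by (auto simp: set_level)
  then have "set (levels k) \<inter> set (level (Suc k)) = {}"
    by (simp add: disjoint_iff set_levels) (metis Suc_n_not_le_n)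
  moreover have "distinct (level j)" for j
    using port_eq_triple_iff[of Q _ j j] by (simp add: level_def port_eq_iff eq_commute[of "3 * j"])
  ultimately show ?case using Suc by simp
qed

lemma rung_in_edges: "j \<in> Q \<Longrightarrow> rung Q s j \<in> edges G"
  unfolding edges_ring_graph_iff by blast

lemma successively_levels:
  "k \<le> n \<Longrightarrow> successively (\<lambda>x y. {x, y} \<in> edges G) (levels k)"
proof (induction k)
  case 0
  then show ?case using zero_notin by (simp add: level_def)
next
  case (Suc k)
  \<comment> \<open>\<open>odd (Suc k)\<close> is \<open>even k\<close>: level \<open>Suc k\<close>
    is entered on the side on which level \<open>k\<close> was left.\<close>
  have "{last (levels k), hd (level (Suc k))} = link Q (even k) k"
    by (simp add: last_levels level_simps link_def)
  with Suc.prems have "{last (levels k), hd (level (Suc k))} \<in> edges G"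
    unfolding edges_ring_graph_iff by (metis Suc_le_lessD)
  moreover have "successively (\<lambda>x y. {x, y} \<in> edges G) (level j)" for j
    using rung_in_edges[of j] insert_commute[of "3 * j"] by (simp add: level_def rung_def)
  ultimately show ?case
    using Suc.IH Suc.prems by (simp add: successively_append_iff)
qed

lemma HC_nonempty: "HC G \<noteq> {}"
proof -
  let ?vs = "levels n"
  have set: "set ?vs = verts G"
  proof (intro set_eqI iffI)
    fix v assume "v \<in> verts G"
    then show "v \<in> set ?vs"
      unfolding verts_ring_graph_iff set_levels set_level
      using Q by (metis greaterThanLessThan_iff less_imp_le subsetD)
  next
    fix v assume "v \<in> set ?vs"
    then show "v \<in> verts G"
      unfolding set_levels set_level using port_in_verts verts_ring_graph_iff by blast
  qed
  have "{last ?vs, hd ?vs} \<in> edges G"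
    using last_notin by (simp add: last_levels hd_levels edges_ring_graph_iff port_single)
  then have "cycle_edges ?vs \<subseteq> edges G"
    by (intro cycle_edges_subset_if_successively successively_levels last_levels) simp_all
  moreover have "3 \<le> length ?vs"
  proof -
    have "{0, 3, 6} \<subseteq> verts G"
    proof -
      have "3 * j \<in> verts G" if "j \<le> n" for j
        using that verts_ring_graph_iff by blast
      from this[of 0] this[of 1] this[of 2] show ?thesis using n by simp
    qed
    then have "card {0, 3, 6 :: nat} \<le> card (set ?vs)"
      using set by (intro card_mono finite_set) simp
    then show ?thesis by (simp add: distinct_card distinct_levels)
  qed
  ultimately have "cycle_edges ?vs \<in> HC G"
    using set distinct_levels by (auto simp: HC_def is_cycle_def intro!: exI[of _ ?vs])
  then show ?thesis by blast
qed

end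

section \<open>Gadgets\<close>

text \<open>Level \<open>z - 1\<close> has degree 2, so every Hamiltonian cycle enters level \<open>z\<close> from the left by
  exactly one edge.\<close>

locale gadget = ring +
  fixes z k :: nat
  assumes z: "2 \<le> z" and k: "2 \<le> k" and zk: "z + k \<le> n"
    and single: "z - 2 \<notin> Q" "z - 1 \<notin> Q" "z \<notin> Q" "z + k \<notin> Q"
    and run: "{z<..<z + k} \<subseteq> Q"
begin

text \<open>The side alternates with the parity of \<open>j\<close>, as the cycle changes sides at
  each triple; \<open>t\<close> is the side at even \<open>j\<close>.\<close>

definition half :: "bool \<Rightarrow> nat set set" where
  "half t = (\<lambda>j. link Q (t = even j) j) ` {z..<z + k}"

text \<open>Modulo 3 the centre of a triple is 0 and its ports are 1 and 2, which doubling
  exchanges.\<close>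

definition flip :: "nat \<Rightarrow> nat" where
  "flip v = (if z < v div 3 \<and> v div 3 < z + k then 3 * (v div 3) + 2 * (v mod 3) mod 3 else v)"

lemma in_run: "z < j \<Longrightarrow> j < z + k \<Longrightarrow> j \<in> Q"
  using run by auto

text \<open>Here \<open>2 \<le> k\<close> matters: every link of the gadget touches a triple, so its
  two sides are different edges. For \<open>k = 1\<close> the halves would coincide.\<close>

lemma end_of_link_in_Q: "z \<le> j \<Longrightarrow> j < z + k \<Longrightarrow> j \<in> Q \<or> Suc j \<in> Q"
  using in_run[of j] in_run[of "Suc j"] k by (cases "j = z") auto

lemma finite_half: "finite (half t)"
  by (simp add: half_def)

lemma card_half: "card (half t) = k"
  unfolding half_def by (subst card_image) (auto simp: inj_on_def link_eq_iff)

lemma half_disjoint: "half t \<inter> half (\<not> t) = {}"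
  using end_of_link_in_Q by (auto simp: half_def link_eq_iff)

lemma half_subset_edges: "half t \<subseteq> edges G"
proof -
  have "link Q s j \<in> edges G" if "j < n" for s j
    using that unfolding edges_ring_graph_iff by blast
  then show ?thesis using zk by (auto simp: half_def)
qed

section \<open>Edges that a Hamiltonian cycle is forced to use\<close>

lemma incident_port:
  assumes "j \<in> Q" "e \<in> edges G" "port Q s j \<in> e"
  shows "e \<in> {rung Q s j, link Q s (j - 1), link Q s j}"
  using assms(2) unfolding edges_ring_graph_iff
proof (elim disjE exE bexE conjE)
  assume "e = {3 * n, 0}"
  with assms show ?thesis
    using port_eq_triple_iff[of Q s j n] port_eq_triple_iff[of Q s j 0] by simp
next
  fix s' j' assume e: "e = link Q s' j'"
  with assms(3) have "port Q s j = port Q s' j' \<or> port Q s j = port Q s' (Suc j')"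
    by (simp add: link_def)
  with e assms(1) show ?thesis by (auto simp: port_eq_iff)
next
  fix s' j' assume "j' \<in> Q" "e = rung Q s' j'"
  with assms show ?thesis by (auto simp: rung_def port_eq_iff port_eq_triple_iff)
qed

lemma incident_center:
  assumes "j \<in> Q" "e \<in> edges G" "3 * j \<in> e"
  shows "e \<in> {rung Q True j, rung Q False j}"
  using assms(2) unfolding edges_ring_graph_iff
proof (elim disjE exE bexE conjE)
  assume "e = {3 * n, 0}"
  with assms show ?thesis using zero_notin last_notin by auto
next
  fix s' j' assume "e = link Q s' j'"
  with assms(3) have "port Q s' j' = 3 * j \<or> port Q s' (Suc j') = 3 * j"
    by (auto simp: link_def)
  with assms(1) show ?thesis by (auto simp: port_eq_triple_iff)
next
  fix s' j' assume j': "j' \<in> Q" "e = rung Q s' j'"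
  with assms(3) have "3 * j = 3 * j' \<or> port Q s' j' = 3 * j" by (auto simp: rung_def)
  with assms(1) j' show ?thesis by (cases s') (auto simp: port_eq_triple_iff)
qed

lemma incident_single:
  assumes "j \<notin> Q" "0 < j" "j < n" "e \<in> edges G" "3 * j \<in> e"
  shows "\<exists>s. e = link Q s (j - 1) \<or> e = link Q s j"
  using assms(4) unfolding edges_ring_graph_iff
proof (elim disjE exE bexE conjE)
  assume "e = {3 * n, 0}"
  with assms show ?thesis by auto
next
  fix s' j' assume e: "e = link Q s' j'"
  with assms(5) have "port Q s' j' = 3 * j \<or> port Q s' (Suc j') = 3 * j"
    by (auto simp: link_def)
  with e show ?thesis by (auto simp: port_eq_triple_iff)
next
  fix s' j' assume j': "j' \<in> Q" "e = rung Q s' j'"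
  with assms(5) have "3 * j = 3 * j' \<or> port Q s' j' = 3 * j" by (auto simp: rung_def)
  with assms(1) j' show ?thesis by (auto simp: port_eq_triple_iff)
qed

context
  fixes X assumes X: "X \<in> HC G"
begin

lemma degree: "v \<in> verts G \<Longrightarrow> card {e \<in> X. v \<in> e} = 2"
  using HC_degree[OF X] .

lemma center_in_verts: "j \<le> n \<Longrightarrow> 3 * j \<in> verts G"
  using verts_ring_graph_iff by blast

lemma rung_in_HC:
  assumes "j \<in> Q"
  shows "rung Q s j \<in> X"
proof -
  have sub: "{e \<in> X. 3 * j \<in> e} \<subseteq> {rung Q True j, rung Q False j}"
    using incident_center[OF assms] HC_subset[OF X] by blast
  have "j \<le> n" using assms Q by auto
  from card_two_subset_pair[OF degree[OF center_in_verts[OF this]] sub]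
  show ?thesis by (cases s) auto
qed

text \<open>The port has three edges and its rung is already on the cycle, so one of the links to
  the left and right remains.\<close>

lemma link_alternates:
  assumes "z < j" "j < z + k"
  shows "link Q s j \<in> X \<longleftrightarrow> link Q s (j - 1) \<notin> X"
proof -
  have j: "j \<in> Q" "j \<le> n" "j - 1 \<noteq> j" using assms in_run zk by auto
  let ?Y = "{e \<in> X. port Q s j \<in> e}"
  have "link Q s j \<in> ?Y \<longleftrightarrow> link Q s (j - 1) \<notin> ?Y"
  proof (rule card_two_subset_triple)
    show "card ?Y = 2" using j by (intro degree port_in_verts)
    show "?Y \<subseteq> {rung Q s j, link Q s j, link Q s (j - 1)}"
      using incident_port[OF j(1)] HC_subset[OF X] by blast
    show "rung Q s j \<in> ?Y" using rung_in_HC[OF j(1)] by (simp add: rung_def)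
  qed (use j in \<open>auto simp: rung_neq_link link_eq_iff\<close>)
  moreover have "port Q s j \<in> link Q s j" "port Q s j \<in> link Q s (j - 1)"
    using assms by (auto simp: link_def)
  ultimately show ?thesis by simp
qed

lemma start_in_HC: "link Q s (z - 1) \<in> X"
proof -
  have z': "z - 1 \<notin> Q" "0 < z - 1" "z - 1 < n" "z - 1 \<le> n" "Suc (z - 1) = z" "Suc (z - 2) = z - 1" "z - 1 - 1 = z - 2"
    using single z zk by auto
  have "{e \<in> X. 3 * (z - 1) \<in> e} \<subseteq> {link Q s (z - 2), link Q s (z - 1)}"
  proof
    fix e assume "e \<in> {e \<in> X. 3 * (z - 1) \<in> e}"
    then obtain s' where "e = link Q s' (z - 2) \<or> e = link Q s' (z - 1)"
      using incident_single[OF z'(1-3), of e] HC_subset[OF X] z' by auto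
    \<comment> \<open>Levels \<open>z - 2\<close>, \<open>z - 1\<close> and \<open>z\<close> are
      single, so the side of these links is immaterial.\<close>
    moreover have "link Q s' (z - 2) = link Q s (z - 2)" "link Q s' (z - 1) = link Q s (z - 1)"
      using single z' by (simp_all add: link_eq_iff)
    ultimately show "e \<in> {link Q s (z - 2), link Q s (z - 1)}" by auto
  qed
  from card_two_subset_pair[OF degree[OF center_in_verts[OF z'(4)]] this] show ?thesis by simp
qed

text \<open>Vertex \<open>3 * z\<close> has one edge from the left, which is forced, and two to the
  right.\<close>

lemma start_splits: "link Q True z \<in> X \<longleftrightarrow> link Q False z \<notin> X"
proof -
  have z': "0 < z" "z < n" "Suc z \<in> Q" "z - 1 \<noteq> z" "Suc (z - 1) = z"
    using z k zk in_run by auto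
  let ?Y = "{e \<in> X. 3 * z \<in> e}"
  have "link Q True z \<in> ?Y \<longleftrightarrow> link Q False z \<notin> ?Y"
  proof (rule card_two_subset_triple)
    show "card ?Y = 2" using z' by (intro degree center_in_verts) simp
    show "?Y \<subseteq> {link Q True (z - 1), link Q True z, link Q False z}"
    proof
      fix e assume "e \<in> ?Y"
      then obtain s where "e = link Q s (z - 1) \<or> e = link Q s z"
        using incident_single[OF single(3) z'(1,2)] HC_subset[OF X] by blast
      moreover have "link Q s (z - 1) = link Q True (z - 1)"
        using single z' by (simp add: link_eq_iff)
      ultimately show "e \<in> {link Q True (z - 1), link Q True z, link Q False z}"
        by (cases s) auto
    qed
    show "link Q True (z - 1) \<in> ?Y"
      using start_in_HC z' single by (auto simp: link_def port_def)
  qed (use z' in \<open>auto simp: link_eq_iff\<close>)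
  moreover have "3 * z \<in> link Q s z" for s
    using single by (simp add: link_def port_def)
  ultimately show ?thesis by simp
qed

text \<open>Alternation at the ports carries the choice made at level \<open>z\<close> through the
  whole gadget.\<close>

lemma link_in_HC_iff:
  assumes "z \<le> j" "j < z + k"
  shows "link Q s j \<in> X \<longleftrightarrow> (((link Q True z \<in> X) = s) = (even j = even z))"
  using assms
proof (induction j rule: dec_induct)
  case base
  then show ?case using start_splits by (cases s) auto
next
  case (step j)
  then show ?case using link_alternates[of "Suc j" s] by auto
qed

lemma half_cases: "\<exists>t. half t \<subseteq> X \<and> half (\<not> t) \<inter> X = {}"
proof -
  \<comment> \<open>The half is named by its side at even levels: the side used at \<open>z\<close>
    if \<open>z\<close> is even, the opposite one otherwise.\<close>
  let ?t = "(link Q True z \<in> X) = even z"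
  have "link Q (t = even j) j \<in> X \<longleftrightarrow> t = ?t" if "z \<le> j" "j < z + k" for t j
    using link_in_HC_iff[OF that] by auto
  then have "half ?t \<subseteq> X \<and> half (\<not> ?t) \<inter> X = {}"
    unfolding half_def by auto
  then show ?thesis by blast
qed

end

section \<open>The reflection of a gadget\<close>

lemma flip_port:
  "flip (port Q s j) = port Q (if z \<le> j \<and> j < z + k then \<not> s else s) j"
  "flip (port Q s (Suc j)) = port Q (if z \<le> j \<and> j < z + k then \<not> s else s) (Suc j)"
proof -
  have run: "flip (port Q s j) = port Q (\<not> s) j" if "z < j" "j < z + k" for s j
    using that in_run[OF that] unfolding flip_def port_div by (simp add: port_def)
  have out: "flip (port Q s j) = port Q s j" if "\<not> (z < j \<and> j < z + k)" for s j
    unfolding flip_def port_div using that by (rule if_not_P)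
  \<comment> \<open>Ports of the single levels \<open>z\<close> and \<open>z + k\<close> do not
    depend on the side. Hence both equations can share the condition under which the link from
    \<open>j\<close> to \<open>Suc j\<close> belongs to the gadget.\<close>
  have single': "port Q (\<not> s) z = port Q s z" "port Q (\<not> s) (z + k) = port Q s (z + k)" for s
    using single by (simp_all add: port_def)
  show "flip (port Q s j) = port Q (if z \<le> j \<and> j < z + k then \<not> s else s) j"
    using run[of j s] out[of j s] single'(1)[of s] by (cases "j = z") auto
  show "flip (port Q s (Suc j)) = port Q (if z \<le> j \<and> j < z + k then \<not> s else s) (Suc j)"
    using run[of "Suc j" s] out[of "Suc j" s] single'(2)[of s]
    by (cases "Suc j = z + k"; cases "Suc j = z") auto
qed

lemma flip_center: "flip (3 * j) = 3 * j"
  by (simp add: flip_def)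

lemma flip_flip: "flip (flip v) = v"
proof -
  \<comment> \<open>Doubling twice multiplies by 4, which is 1 modulo 3.\<close>
  have "v mod 3 = 0 \<or> v mod 3 = 1 \<or> v mod 3 = 2" by auto
  then have "(2 * (2 * (v mod 3) mod 3)) mod 3 = v mod 3" "2 * (v mod 3) mod 3 < 3" by auto
  then show ?thesis unfolding flip_def by auto
qed

lemma inj_flip: "inj flip"
  by (metis injI flip_flip)

lemma flip_link: "flip ` link Q s j = link Q (if z \<le> j \<and> j < z + k then \<not> s else s) j"
  by (simp only: link_def image_insert image_empty flip_port(1)[of s j] flip_port(2))

lemma flip_rung: "\<exists>s'. flip ` rung Q s j = rung Q s' j"
  unfolding rung_def image_insert image_empty flip_port flip_center by blast

lemma flip_closing: "flip ` {3 * n, 0} = {3 * n, 0}"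
  using flip_center[of 0] by (simp add: flip_center)

lemma flip_verts: "flip ` verts G = verts G"
proof -
  have "flip v \<in> verts G" if "v \<in> verts G" for v
    using that unfolding verts_ring_graph_iff
  proof (elim disjE exE bexE conjE)
    fix j assume "j \<le> n" "v = 3 * j"
    then show "(\<exists>j\<le>n. flip v = 3 * j) \<or> (\<exists>s. \<exists>j\<in>Q. flip v = port Q s j)"
      using flip_center by blast
  next
    fix s j assume "j \<in> Q" "v = port Q s j"
    then show "(\<exists>j\<le>n. flip v = 3 * j) \<or> (\<exists>s. \<exists>j\<in>Q. flip v = port Q s j)"
      using flip_port(1) by blast
  qed
  then have "flip ` verts G \<subseteq> verts G" by blast
  \<comment> \<open>As \<open>flip\<close> is an involution, mapping into the vertex set already
    means mapping onto it.\<close>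
  moreover from this have "flip ` flip ` verts G \<subseteq> flip ` verts G" by blast
  then have "verts G \<subseteq> flip ` verts G" by (simp add: image_image flip_flip)
  ultimately show ?thesis by blast
qed

lemma flip_edges: "e \<in> edges G \<Longrightarrow> flip ` e \<in> edges G"
  unfolding edges_ring_graph_iff
proof (elim disjE exE bexE conjE)
  assume "e = {3 * n, 0}"
  then have "flip ` e = {3 * n, 0}" by (simp only: flip_closing)
  then show "flip ` e = {3 * n, 0} \<or> (\<exists>s. \<exists>j<n. flip ` e = link Q s j) \<or>
      (\<exists>s. \<exists>j\<in>Q. flip ` e = rung Q s j)" ..
next
  fix s j assume "j < n" "e = link Q s j"
  then show "flip ` e = {3 * n, 0} \<or> (\<exists>s. \<exists>j<n. flip ` e = link Q s j) \<or>
      (\<exists>s. \<exists>j\<in>Q. flip ` e = rung Q s j)"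
    using flip_link[of s j] by blast
next
  fix s j assume "j \<in> Q" "e = rung Q s j"
  then show "flip ` e = {3 * n, 0} \<or> (\<exists>s. \<exists>j<n. flip ` e = link Q s j) \<or>
      (\<exists>s. \<exists>j\<in>Q. flip ` e = rung Q s j)"
    using flip_rung[of s j] by blast
qed

text \<open>Reflecting the gadget exchanges its two halves and permutes the rungs, all of which lie on
  the cycle.\<close>

lemma HC_swap:
  assumes X: "X \<in> HC G"
  obtains t where "half t \<subseteq> X" "half (\<not> t) \<inter> X = {}" "(X - half t) \<union> half (\<not> t) \<in> HC G"
proof -
  from half_cases[OF X] obtain t where t: "half t \<subseteq> X" "half (\<not> t) \<inter> X = {}" by blast
  let ?Y = "(`) flip ` X"
  have fin: "finite X" using HC_subset[OF X] finite_edges by (rule finite_subset)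
  \<comment> \<open>One inclusion is enough: since the halves have equal size, both sides have the
    same finite cardinality.\<close>
  have "?Y \<subseteq> (X - half t) \<union> half (\<not> t)"
  proof
    fix e' assume "e' \<in> ?Y"
    then obtain e where e: "e \<in> X" "e' = flip ` e" by blast
    then have "e \<in> edges G" using HC_subset[OF X] by blast
    then consider "e = {3 * n, 0}" | s j where "j < n" "e = link Q s j" | s j where "j \<in> Q" "e = rung Q s j"
      unfolding edges_ring_graph_iff by blast
    then show "e' \<in> (X - half t) \<union> half (\<not> t)"
    proof cases
      case 1
      have "e \<notin> half t"
      proof
        assume "e \<in> half t"
        then obtain s j where j: "z \<le> j" "j < z + k" "e = link Q s j" by (auto simp: half_def)
        with 1 have "{3 * n, 0} = link Q s j" by simp
        then have "(\<lambda>v. v div 3) ` {3 * n, 0} = {j, Suc j}" by (simp add: link_def)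
        with z j(1) show False by (auto simp: doubleton_eq_iff)
      qed
      with 1 e show ?thesis by (simp only: flip_closing) blast
    next
      case 2
      show ?thesis
      proof (cases "z \<le> j \<and> j < z + k")
        case True
        then have in_half: "link Q s j \<in> half (s = even j)" for s
        proof -
          have "((s = even j) = even j) = s" by auto
          with True show ?thesis unfolding half_def by (intro image_eqI[of _ _ j]) simp_all
        qed
        from True e 2 have e': "e' = link Q (\<not> s) j" by (simp add: flip_link)
        show ?thesis
        proof (cases "t = (s = even j)")
          case True
          then have "(\<not> t) = ((\<not> s) = even j)" by auto
          with in_half[of "\<not> s"] e' show ?thesis by simp
        next
          case False
          \<comment> \<open>In this case the link would lie in the half that \<open>X\<close>
            avoids.\<close>
          then have "(\<not> t) = (s = even j)" by auto
          with in_half[of s] 2 e t show ?thesis by auto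
        qed
      next
        case False
        then have "e' = e" by (simp only: 2 e flip_link if_False)
        moreover have "e \<notin> half t" using False 2 by (auto simp: half_def link_eq_iff)
        ultimately show ?thesis using e by simp
      qed
    next
      case 3
      from flip_rung[of s j] e 3 obtain s' where "e' = rung Q s' j" by auto
      with rung_in_HC[OF X 3(1)] show ?thesis by (auto simp: half_def rung_neq_link)
    qed
  qed
  moreover have "card ?Y = card ((X - half t) \<union> half (\<not> t))"
  proof -
    have "card ?Y = card X"
      by (intro card_image inj_onI) (metis inj_flip inj_image_eq_iff)
    also have "\<dots> = card (X - half t) + card (half t)"
      using fin t(1) finite_half card_mono[OF fin t(1)] by (simp add: card_Diff_subset)
    also have "\<dots> = card ((X - half t) \<union> half (\<not> t))"
      using fin t(2) finite_half by (subst card_Un_disjoint) (auto simp: card_half)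
    finally show ?thesis .
  qed
  ultimately have "?Y = (X - half t) \<union> half (\<not> t)"
    using fin finite_half by (intro card_subset_eq) auto
  moreover have "?Y \<in> HC G"
    using X inj_flip flip_verts flip_edges by (intro HC_image) (auto intro: inj_on_subset)
  ultimately show ?thesis using that[of t] t by simp
qed

lemma not_isolates:
  fixes \<omega> :: "nat set \<Rightarrow> nat"
  assumes eq: "sum \<omega> (half True) = sum \<omega> (half False)"
  shows "\<not> isolates \<omega> (HC G)"
proof (rule not_isolates_if_swap)
  fix X assume X: "X \<in> HC G"
  then obtain t where t: "half t \<subseteq> X" "half (\<not> t) \<inter> X = {}" "(X - half t) \<union> half (\<not> t) \<in> HC G"
    by (rule HC_swap)
  have fin: "finite X" using HC_subset[OF X] finite_edges by (rule finite_subset)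
  have "half t \<noteq> {}" using card_half[of t] k by auto
  then have "(X - half t) \<union> half (\<not> t) \<noteq> X" using t(1) half_disjoint[of t] by blast
  moreover have "sum \<omega> ((X - half t) \<union> half (\<not> t)) = sum \<omega> X"
  proof -
    have "sum \<omega> ((X - half t) \<union> half (\<not> t)) = sum \<omega> (X - half t) + sum \<omega> (half (\<not> t))"
      using fin t(2) finite_half by (intro sum.union_disjoint) auto
    also have "sum \<omega> (half (\<not> t)) = sum \<omega> (half t)" using eq by (cases t) auto
    also have "sum \<omega> (X - half t) + sum \<omega> (half t) = sum \<omega> X"
      using fin t(1) by (metis sum.subset_diff)
    finally show ?thesis .
  qed
  ultimately show "\<exists>Y\<in>HC G. Y \<noteq> X \<and> sum \<omega> Y = sum \<omega> X"
    using t(3) by (intro bexI[of _ "(X - half t) \<union> half (\<not> t)"] conjI)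
qed

end

section \<open>Disjoint sets of equal weight\<close>

text \<open>There are more \<open>r\<close>-subsets than the \<open>r * W + 1\<close> possible sums,
  so two have equal weight; removing their intersection keeps sizes and weights equal.\<close>

lemma equal_sum_disjoint_pair:
  fixes w :: "'a \<Rightarrow> nat"
  assumes fin: "finite E" and le: "\<And>e. e \<in> E \<Longrightarrow> w e \<le> W"
    and choose: "r * W + 1 < card E choose r"
  obtains A B where "A \<subseteq> E" "B \<subseteq> E" "A \<inter> B = {}" "card A = card B" "0 < card A" "card A \<le> r"
    "sum w A = sum w B"
proof -
  let ?F = "{X. X \<subseteq> E \<and> card X = r}"
  have "sum w ` ?F \<subseteq> {..r * W}"
  proof clarify
    fix X assume "X \<subseteq> E" "r = card X"
    then show "sum w X \<le> card X * W"
      using le sum_bounded_above[of X w W] by auto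
  qed
  then have "card (sum w ` ?F) \<le> card {..r * W}" by (intro card_mono) auto
  also have "\<dots> < card ?F" using choose n_subsets[OF fin] by simp
  finally have "\<not> inj_on (sum w) ?F" by (rule pigeonhole)
  then obtain X Y where XY: "X \<subseteq> E" "Y \<subseteq> E" "card X = r" "card Y = r" "sum w X = sum w Y" "X \<noteq> Y"
    by (auto simp: inj_on_def)
  have finXY: "finite X" "finite Y" using XY fin finite_subset by auto
  have card: "card (X - Y) = card (Y - X)"
    using finXY XY by (simp add: card_Diff_subset_Int Int_commute)
  have eq: "sum w (X - Y) + sum w (X \<inter> Y) = sum w (Y - X) + sum w (X \<inter> Y)"
    using sum.Int_Diff[OF finXY(1), of w Y] sum.Int_Diff[OF finXY(2), of w X] XY(5)
    by (simp add: Int_commute add.commute)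
  have "X - Y \<noteq> {}"
  proof
    assume "X - Y = {}"
    moreover from this have "card (Y - X) = 0" using card by (simp only: card.empty)
    then have "Y - X = {}" using finXY(2) by (simp only: card_0_eq finite_Diff)
    ultimately show False using XY(6) by blast
  qed
  then have "0 < card (X - Y)" using finXY(1) by (simp only: card_gt_0_iff finite_Diff simp_thms)
  moreover have "card (X - Y) \<le> r" using finXY(1) XY(3) by (metis Diff_subset card_mono)
  ultimately show ?thesis
    using XY card eq by (intro that[of "X - Y" "Y - X"]) auto
qed

text \<open>A gadget needs halves of size at least 2, so two pairs are merged.\<close>

lemma equal_sum_disjoint_pair_ge_2:
  fixes w :: "'a \<Rightarrow> nat"
  assumes fin: "finite E" and le: "\<And>e. e \<in> E \<Longrightarrow> w e \<le> W"
    and choose: "r * W + 1 < M choose r" and M: "M + 2 * r \<le> card E"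
  obtains A B where "A \<subseteq> E" "B \<subseteq> E" "A \<inter> B = {}" "card A = card B" "2 \<le> card A" "card A \<le> 2 * r"
    "sum w A = sum w B"
proof -
  have mono: "r * W + 1 < card E' choose r" if "M \<le> card E'" for E' :: "'a set"
    using choose binomial_right_mono[OF that, of r] by simp
  have "M \<le> card E" using M by simp
  obtain A B where AB: "A \<subseteq> E" "B \<subseteq> E" "A \<inter> B = {}" "card A = card B" "0 < card A" "card A \<le> r"
    "sum w A = sum w B" by (rule equal_sum_disjoint_pair[OF fin le mono[OF \<open>M \<le> card E\<close>]])
  have finAB: "finite A" "finite B" using AB fin finite_subset by auto
  have "card (A \<union> B) \<le> 2 * r" using AB finAB by (simp add: card_Un_disjoint)
  then have M': "M \<le> card (E - (A \<union> B))"
    using M finAB diff_card_le_card_Diff[of "A \<union> B" E] by simp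
  have "finite (E - (A \<union> B))" "\<And>e. e \<in> E - (A \<union> B) \<Longrightarrow> w e \<le> W"
    using fin le by auto
  then obtain C D where CD: "C \<subseteq> E - (A \<union> B)" "D \<subseteq> E - (A \<union> B)" "C \<inter> D = {}" "card C = card D"
    "0 < card C" "card C \<le> r" "sum w C = sum w D" by (rule equal_sum_disjoint_pair[OF _ _ mono[OF M']])
  have finCD: "finite C" "finite D" using CD fin finite_subset by auto
  have disj: "A \<inter> C = {}" "B \<inter> D = {}" "A \<inter> D = {}" "B \<inter> C = {}" using CD by auto
  show ?thesis
    using AB CD finAB finCD disj
    by (intro that[of "A \<union> C" "B \<union> D"]) (auto simp: card_Un_disjoint sum.union_disjoint)
qed

text \<open>The choice is greedy. Each function takes up two sets of size at most
  \<open>2 * r\<close>, whence \<open>4 * r * l\<close>; the other \<open>M + 2 * r\<close> elements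
  are what a single choice requires.\<close>

lemma equal_sum_disjoint_family:
  fixes w :: "nat \<Rightarrow> 'a \<Rightarrow> nat"
  assumes fin: "finite E" and le: "\<And>i e. i < l \<Longrightarrow> e \<in> E \<Longrightarrow> w i e \<le> W"
    and choose: "r * W + 1 < M choose r" and M: "M + 2 * r + 4 * r * l \<le> card E"
  shows "\<exists>P :: nat \<times> bool \<Rightarrow> 'a set. disjoint_family_on P ({..<l} \<times> UNIV) \<and>
      (\<forall>i<l. \<forall>s. P (i, s) \<subseteq> E) \<and> (\<forall>i<l. \<forall>s. card (P (i, s)) = card (P (i, True))) \<and>
      (\<forall>i<l. 2 \<le> card (P (i, True)) \<and> card (P (i, True)) \<le> 2 * r \<and>
        sum (w i) (P (i, True)) = sum (w i) (P (i, False)))"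
  using le M
proof (induction l)
  case 0
  then show ?case by (simp add: disjoint_family_on_def)
next
  case (Suc l)
  have "\<And>i e. i < l \<Longrightarrow> e \<in> E \<Longrightarrow> w i e \<le> W" "M + 2 * r + 4 * r * l \<le> card E"
    using Suc.prems by auto
  from Suc.IH[OF this] obtain P where P: "disjoint_family_on P ({..<l} \<times> UNIV)" "\<And>i s. i < l \<Longrightarrow> P (i, s) \<subseteq> E"
    "\<And>i s. i < l \<Longrightarrow> card (P (i, s)) = card (P (i, True))"
    "\<And>i. i < l \<Longrightarrow> 2 \<le> card (P (i, True)) \<and> card (P (i, True)) \<le> 2 * r \<and>
      sum (w i) (P (i, True)) = sum (w i) (P (i, False))"
    by blast
  define U where "U = (\<Union>x\<in>{..<l} \<times> UNIV. P x)"
  have U: "U \<subseteq> E" "finite U" using P(2) fin by (auto simp: U_def intro: finite_subset)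
  have "card U \<le> (\<Sum>x\<in>{..<l} \<times> UNIV. card (P x))"
    unfolding U_def by (intro card_UN_le) simp
  also have "\<dots> \<le> of_nat (card ({..<l} \<times> (UNIV :: bool set))) * (2 * r)"
  proof (rule sum_bounded_above)
    fix x assume "x \<in> {..<l} \<times> (UNIV :: bool set)"
    then obtain i s where "x = (i, s)" "i < l" by auto
    then show "card (P x) \<le> 2 * r" using P(3)[of i s] P(4)[of i] by simp
  qed
  also have "\<dots> = 4 * r * l" by (simp add: card_cartesian_product)
  finally have M': "M + 2 * r \<le> card (E - U)"
    using Suc.prems(2) diff_card_le_card_Diff[OF U(2), of E] by simp
  have "finite (E - U)" "\<And>e. e \<in> E - U \<Longrightarrow> w l e \<le> W"
    using fin Suc.prems(1) by auto
  then obtain A B where AB: "A \<subseteq> E - U" "B \<subseteq> E - U" "A \<inter> B = {}" "card A = card B" "2 \<le> card A"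
    "card A \<le> 2 * r" "sum (w l) A = sum (w l) B"
    by (rule equal_sum_disjoint_pair_ge_2[OF _ _ choose M'])
  define P' where "P' = (\<lambda>(i, s). if i = l then (if s then A else B) else P (i, s))"
  have new: "P' (l, s) = (if s then A else B)" and old: "i < l \<Longrightarrow> P' (i, s) = P (i, s)" for i s
    by (auto simp: P'_def)
  have PU: "P (i, s) \<subseteq> U" if "i < l" for i s using that by (auto simp: U_def)
  have "disjoint_family_on P' ({..<Suc l} \<times> UNIV)"
    unfolding disjoint_family_on_def
  proof (intro ballI impI)
    fix x y assume xy: "x \<in> {..<Suc l} \<times> (UNIV :: bool set)" "y \<in> {..<Suc l} \<times> (UNIV :: bool set)" "x \<noteq> y"
    obtain i s j t where x: "x = (i, s)" and y: "y = (j, t)" by (metis surj_pair)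
    with xy have "i < l \<or> i = l" "j < l \<or> j = l" "i = j \<longrightarrow> s \<noteq> t" by auto
    then consider "i < l" "j < l" | "i < l" "j = l" | "i = l" "j < l" | "i = l" "j = l" "s \<noteq> t"
      by blast
    then have "P' (i, s) \<inter> P' (j, t) = {}"
    proof cases
      case 1
      then show ?thesis
        using disjoint_family_onD[OF P(1), of "(i, s)" "(j, t)"] \<open>x \<noteq> y\<close> x y by (simp add: old)
    next
      case 2
      then show ?thesis using PU[of i s] AB(1,2) by (auto simp: old new)
    next
      case 3
      then show ?thesis using PU[of j t] AB(1,2) by (auto simp: old new)
    next
      case 4
      then show ?thesis using AB(3) by (auto simp: new)
    qed
    then show "P' x \<inter> P' y = {}" by (simp only: x y)
  qed
  moreover have "P' (i, s) \<subseteq> E" if "i < Suc l" for i s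
    using that P(2)[of i s] AB(1,2) by (cases "i = l") (auto simp: old new)
  moreover have "card (P' (i, s)) = card (P' (i, True))" if "i < Suc l" for i s
    using that P(3)[of i s] AB(4) by (cases "i = l") (auto simp: old new)
  moreover have "2 \<le> card (P' (i, True)) \<and> card (P' (i, True)) \<le> 2 * r \<and>
      sum (w i) (P' (i, True)) = sum (w i) (P' (i, False))" if "i < Suc l" for i
    using that P(4)[of i] AB by (cases "i = l") (auto simp: old new)
  ultimately show ?case by blast
qed

text \<open>Provides the enumeration that carries halves to chosen sets of numbers. After matching
  one pair of sets, the rests of \<open>E\<close> and \<open>F\<close> still have equal
  size.\<close>

lemma ex_bij_betw_disjoint_family:
  assumes "finite I" "finite E" "finite F" "card E = card F"
    and "disjoint_family_on X I" "disjoint_family_on Y I"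
    and "\<And>i. i \<in> I \<Longrightarrow> X i \<subseteq> E" "\<And>i. i \<in> I \<Longrightarrow> Y i \<subseteq> F" "\<And>i. i \<in> I \<Longrightarrow> card (X i) = card (Y i)"
  shows "\<exists>\<phi>. bij_betw \<phi> E F \<and> (\<forall>i\<in>I. bij_betw \<phi> (X i) (Y i))"
  using assms
proof (induction I arbitrary: E F rule: finite_induct)
  case empty
  then show ?case by (simp add: finite_same_card_bij)
next
  case (insert i I)
  have sub: "X i \<subseteq> E" "Y i \<subseteq> F" and card: "card (X i) = card (Y i)" using insert.prems by auto
  have fin: "finite (X i)" "finite (Y i)"
    using finite_subset[OF sub(1) insert.prems(1)] finite_subset[OF sub(2) insert.prems(2)] by auto
  have disj: "X j \<inter> X i = {}" "Y j \<inter> Y i = {}" if "j \<in> I" for j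
    using that insert.hyps(2) insert.prems(4,5) by (force simp: disjoint_family_on_def)+
  have "\<exists>\<phi>. bij_betw \<phi> (E - X i) (F - Y i) \<and> (\<forall>j\<in>I. bij_betw \<phi> (X j) (Y j))"
  proof (rule insert.IH)
    show "disjoint_family_on X I" "disjoint_family_on Y I"
      using insert.prems(4,5) by (auto intro: disjoint_family_on_mono[rotated])
    show "card (E - X i) = card (F - Y i)"
      using sub fin card insert.prems(3) by (simp add: card_Diff_subset)
    show "X j \<subseteq> E - X i" "Y j \<subseteq> F - Y i" if "j \<in> I" for j
      using disj[OF that] insert.prems(6,7)[of j] that by auto
  qed (use insert.prems in auto)
  then obtain \<phi> where \<phi>: "bij_betw \<phi> (E - X i) (F - Y i)" "\<And>j. j \<in> I \<Longrightarrow> bij_betw \<phi> (X j) (Y j)"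
    by blast
  obtain \<psi> where \<psi>: "bij_betw \<psi> (X i) (Y i)" using fin card finite_same_card_bij by blast
  define \<theta> where "\<theta> v = (if v \<in> X i then \<psi> v else \<phi> v)" for v
  have \<theta>i: "bij_betw \<theta> (X i) (Y i)"
    using \<psi> by (subst bij_betw_cong[of _ \<theta> \<psi>]) (auto simp: \<theta>_def)
  have \<theta>: "bij_betw \<theta> S T" if "bij_betw \<phi> S T" "S \<inter> X i = {}" for S T
    using that by (subst bij_betw_cong[of _ \<theta> \<phi>]) (auto simp: \<theta>_def)
  have "bij_betw \<theta> (X i \<union> (E - X i)) (Y i \<union> (F - Y i))"
    using \<theta>i \<theta>[OF \<phi>(1)] by (intro bij_betw_combine) auto
  then have "bij_betw \<theta> E F" using sub by (simp add: Un_absorb1)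
  moreover have "bij_betw \<theta> (X j) (Y j)" if "j \<in> I" for j
    using \<theta>[OF \<phi>(2)[OF that]] disj[OF that] by simp
  ultimately show ?case using \<theta>i by blast
qed

section \<open>The lower bound\<close>

text \<open>A gadget with halves of size at most \<open>2 * r\<close> occupies at most \<open>2 * r + 1\<close> levels. Blocks of
  \<open>2 * r + 2\<close> levels leave a level of degree 2 before each gadget.\<close>

lemma non_isolated_graph:
  fixes w :: "nat \<Rightarrow> nat \<Rightarrow> nat"
  assumes le: "\<And>i e. i < l \<Longrightarrow> e \<in> {1..m} \<Longrightarrow> w i e \<le> W"
    and choose: "r * W + 1 < M choose r" and M: "M + 2 * r + 4 * r * l \<le> m"
    and m: "4 * ((2 * r + 2) * l + 2) \<le> m"
  obtains G \<phi> where "G \<in> treewidth_class 4" "bij_betw \<phi> (edges G) {1..m}" "HC G \<noteq> {}"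
    "\<forall>i<l. \<not> isolates (w i \<circ> \<phi>) (HC G)"
proof -
  have card_E: "M + 2 * r + 4 * r * l \<le> card {1..m}" using M by simp
  obtain P :: "nat \<times> bool \<Rightarrow> nat set"
    where P: "disjoint_family_on P ({..<l} \<times> UNIV)" "\<And>i s. i < l \<Longrightarrow> P (i, s) \<subseteq> {1..m}"
      "\<And>i s. i < l \<Longrightarrow> card (P (i, s)) = card (P (i, True))"
      "\<And>i. i < l \<Longrightarrow> 2 \<le> card (P (i, True))" "\<And>i. i < l \<Longrightarrow> card (P (i, True)) \<le> 2 * r"
      "\<And>i. i < l \<Longrightarrow> sum (w i) (P (i, True)) = sum (w i) (P (i, False))"
    using equal_sum_disjoint_family[of "{1..m}" l w W r M, OF finite_atLeastAtMost le choose card_E] by blast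
  define k where "k i = card (P (i, True))" for i
  define R where "R = 2 * r + 2"
  \<comment> \<open>The offset 2 provides the single levels \<open>z i - 2\<close> and
    \<open>z i - 1\<close>. As \<open>k i + 2 \<le> R\<close>, a gadget ends at the latest on the
    first level of the next block, which is single as well.\<close>
  define z where "z i = R * i + 2" for i
  define Q where "Q = (\<Union>i<l. {z i<..<z i + k i})"
  define N where "N = R * l + 2"
  have k: "2 \<le> k i" "k i + 2 \<le> R" if "i < l" for i
    using P(4,5)[OF that] by (auto simp: k_def R_def)
  have next_block: "z i + k i \<le> R * j" if "i < j" "i < l" for i j
  proof -
    have "z i + k i \<le> R * Suc i" using k[OF that(2)] by (simp add: z_def)
    also have "\<dots> \<le> R * j" using that(1) by (intro mult_le_mono2) simp
    finally show ?thesis .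
  qed
  have notin_Q: "x \<notin> Q" if "i < l" "x \<in> {R * i, R * i + 1, z i, z i + k i}" for i x
  proof
    assume "x \<in> Q"
    then obtain j where j: "j < l" "z j < x" "x < z j + k j" by (auto simp: Q_def)
    consider "i < j" | "i = j" | "j < i" by linarith
    then show False
    proof cases
      case 1
      then show ?thesis using next_block[OF 1 that(1)] that(2) j by (auto simp: z_def)
    next
      case 2
      then show ?thesis using that(2) j by (auto simp: z_def)
    next
      case 3
      then show ?thesis using next_block[OF 3 j(1)] that(2) j by (auto simp: z_def)
    qed
  qed
  have zN: "z i + k i \<le> N - 2" if "i < l" for i
    using next_block[OF that that] by (simp add: N_def)
  have QN: "Q \<subseteq> {0<..<N}"
  proof
    fix x assume "x \<in> Q"
    then obtain j where "j < l" "z j < x" "x < z j + k j" by (auto simp: Q_def)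
    with zN[of j] show "x \<in> {0<..<N}" by simp
  qed
  have "ring N Q" using QN by unfold_locales (auto simp: N_def)
  \<comment> \<open>So far there are at most \<open>4 * N \<le> m\<close> edges; appending single
    levels brings their number to exactly \<open>m\<close> and leaves the gadgets alone.\<close>
  define n where "n = N + (m - card (edges (ring_graph N Q)))"
  have "card (edges (ring_graph N Q)) \<le> m"
    using ring.card_edges_le[OF \<open>ring N Q\<close>] m by (simp add: N_def R_def)
  then have card: "card (edges (ring_graph n Q)) = m"
    unfolding n_def card_edges_ring_graph_add[OF \<open>ring N Q\<close>] by simp
  have Nn: "N \<le> n" by (simp add: n_def)
  interpret ring n Q
    using QN Nn by unfold_locales (auto simp: N_def)
  have gadget: "gadget n Q (z i) (k i)" if "i < l" for i
  proof
    show "2 \<le> z i" by (simp add: z_def)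
    show "2 \<le> k i" using k[OF that] by simp
    show "z i + k i \<le> n" using zN[OF that] Nn by linarith
    show "z i - 2 \<notin> Q" "z i - 1 \<notin> Q" "z i \<notin> Q" "z i + k i \<notin> Q"
      using notin_Q[OF that] by (auto simp: z_def)
    show "{z i<..<z i + k i} \<subseteq> Q" using that by (auto simp: Q_def)
  qed
  define X where "X = (\<lambda>(i, s). gadget.half Q (z i) (k i) s)"
  have level_unique: "i = j" if "i < l" "j < l" "z i \<le> x" "x < z i + k i" "z j \<le> x" "x < z j + k j" for i j x
    using next_block[of i j] next_block[of j i] that by (cases i j rule: linorder_cases) (auto simp: z_def)
  have "disjoint_family_on X ({..<l} \<times> UNIV)"
    unfolding disjoint_family_on_def
  proof (intro ballI impI)
    fix x y assume xy: "x \<in> {..<l} \<times> (UNIV :: bool set)" "y \<in> {..<l} \<times> (UNIV :: bool set)" "x \<noteq> y"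
    obtain i s j t where x: "x = (i, s)" and y: "y = (j, t)" by (metis surj_pair)
    with xy have ij: "i \<in> {..<l}" "j \<in> {..<l}" and ne: "(i, s) \<noteq> (j, t)" by auto
    have "X (i, s) \<inter> X (j, t) = {}"
    proof (cases "i = j")
      case True
      with ne have "t = (\<not> s)" by auto
      with True show ?thesis
        using gadget.half_disjoint[OF gadget, of i s] ij by (simp add: X_def)
    next
      case False
      show ?thesis
      proof (rule equals0I)
        fix e assume e: "e \<in> X (i, s) \<inter> X (j, t)"
        obtain x s' where x: "z i \<le> x" "x < z i + k i" "e = link Q s' x"
          using e gadget.half_def[OF gadget[of i]] ij by (auto simp: X_def)
        obtain y t' where y: "z j \<le> y" "y < z j + k j" "e = link Q t' y"
          using e gadget.half_def[OF gadget[of j]] ij by (auto simp: X_def)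
        from x y have "x = y" by (simp add: link_eq_iff)
        with x y level_unique[of i j x] ij False show False by simp
      qed
    qed
    then show "X x \<inter> X y = {}" by (simp only: x y)
  qed
  moreover have "X x \<subseteq> edges G" "P x \<subseteq> {1..m}" "card (X x) = card (P x)" if "x \<in> {..<l} \<times> UNIV" for x
  proof -
    from that obtain i s where x: "x = (i, s)" "i < l" by (cases x) auto
    show "X x \<subseteq> edges G"
      using gadget.half_subset_edges[OF gadget[OF x(2)]] by (simp add: X_def x(1))
    show "P x \<subseteq> {1..m}" unfolding x(1) by (rule P(2)[OF x(2)])
    show "card (X x) = card (P x)"
      using gadget.card_half[OF gadget[OF x(2)]] P(3)[OF x(2), of s] by (simp add: X_def k_def x(1))
  qed
  ultimately obtain \<phi> where \<phi>: "bij_betw \<phi> (edges G) {1..m}"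
      "\<And>x. x \<in> {..<l} \<times> UNIV \<Longrightarrow> bij_betw \<phi> (X x) (P x)"
    using ex_bij_betw_disjoint_family[of "{..<l} \<times> UNIV" "edges G" "{1..m}" X P] P(1) card finite_edges
    by auto
  show ?thesis
  proof
    show "G \<in> treewidth_class 4" by (rule ring_graph_in_treewidth_class)
    show "bij_betw \<phi> (edges G) {1..m}" by (rule \<phi>(1))
    show "HC G \<noteq> {}" by (rule HC_nonempty)
    have "\<not> isolates (w i \<circ> \<phi>) (HC G)" if "i < l" for i
    proof (rule gadget.not_isolates[OF gadget[OF that]])
      have "sum (w i \<circ> \<phi>) (X (i, s)) = sum (w i) (P (i, s))" for s
        using sum.reindex_bij_betw[OF \<phi>(2), of "(i, s)" "w i"] that by (simp add: comp_def)
      with P(6)[OF that]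
      show "sum (w i \<circ> \<phi>) (gadget.half Q (z i) (k i) True) =
          sum (w i \<circ> \<phi>) (gadget.half Q (z i) (k i) False)"
        by (simp add: X_def)
    qed
    then show "\<forall>i<l. \<not> isolates (w i \<circ> \<phi>) (HC G)" by blast
  qed
qed

section \<open>From the resource bounds to a contradiction\<close>

lemma le_max_weight:
  assumes "\<omega> \<in> set (S m)" "e \<in> {1..m}"
  shows "\<omega> e \<le> max_weight S m"
proof -
  \<comment> \<open>Finiteness guarantees that \<open>Sup\<close> is an upper bound of this set of
    naturals.\<close>
  have "{\<omega> e | \<omega> e. \<omega> \<in> set (S m) \<and> e \<in> {1..m}} \<subseteq> (\<lambda>(\<omega>, e). \<omega> e) ` (set (S m) \<times> {1..m})"
    by auto
  then have "finite {\<omega> e | \<omega> e. \<omega> \<in> set (S m) \<and> e \<in> {1..m}}"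
    by (rule finite_subset) simp
  then show ?thesis
    unfolding max_weight_def by (rule le_cSup_finite) (use assms in blast)
qed

text \<open>With more \<open>r\<close>-subsets one graph would defeat every function of the list,
  while half of a nonempty list includes at least one function.\<close>

lemma HC_isolation_scheme_limit:
  assumes S: "HC_isolation_scheme (treewidth_class 4) S"
    and M: "M + 2 * r + 4 * r * length (S m) \<le> m" and m: "4 * ((2 * r + 2) * length (S m) + 2) \<le> m"
  shows "M choose r \<le> r * max_weight S m + 1"
proof (rule ccontr)
  assume "\<not> M choose r \<le> r * max_weight S m + 1"
  then have choose: "r * max_weight S m + 1 < M choose r" by simp
  have le: "(S m ! i) e \<le> max_weight S m" if "i < length (S m)" "e \<in> {1..m}" for i e
    using that by (intro le_max_weight) auto
  obtain G \<phi> where G: "G \<in> treewidth_class 4" "bij_betw \<phi> (edges G) {1..m}" "HC G \<noteq> {}"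
    "\<forall>i<length (S m). \<not> isolates ((S m ! i) \<circ> \<phi>) (HC G)"
    by (rule non_isolated_graph[where w = "\<lambda>i. S m ! i", OF le choose M m])
  have "filter (\<lambda>\<omega>. isolates (\<omega> \<circ> \<phi>) (HC G)) (S m) = []"
    using G(4) by (auto simp: filter_empty_conv in_set_conv_nth)
  moreover have "S m \<noteq> []"
    "real (length (filter (\<lambda>\<omega>. isolates (\<omega> \<circ> \<phi>) (HC G)) (S m))) \<ge> real (length (S m)) / 2"
    using S G(1-3) unfolding HC_isolation_scheme_def by blast+
  ultimately show False by simp
qed

text \<open>Schemes are indexed by edges, their bounds by vertices. A cycle has equally many of
  both, so the bounds at \<open>m\<close> apply to \<open>S m\<close>.\<close>

lemma cycle_in_treewidth_class:
  assumes "3 \<le> m"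
  obtains G where "G \<in> treewidth_class 4" "card (edges G) = m" "card (verts G) = m"
proof -
  have "ring (m - 1) {}" using assms by unfold_locales auto
  then show ?thesis
    using assms that[OF ring.ring_graph_in_treewidth_class] card_edges_cycle[of "m - 1"]
      card_verts_cycle[of "m - 1"]
    by simp
qed

theorem theorem1p6:
  "\<not> (\<exists>(S :: scheme) (b :: nat \<Rightarrow> real) (w :: nat \<Rightarrow> real) (c :: nat).
        HC_isolation_scheme (treewidth_class 4) S \<and>
        uses_random_bits (treewidth_class 4) S b \<and> b \<in> o(\<lambda>n. log 2 (real n)) \<and>
        uses_weights (treewidth_class 4) S w \<and> w \<in> O(\<lambda>n. real n ^ c))"
proof (intro notI, elim exE conjE)
  fix S :: scheme and b w :: "nat \<Rightarrow> real" and c :: nat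
  assume S: "HC_isolation_scheme (treewidth_class 4) S"
    and ub: "uses_random_bits (treewidth_class 4) S b" and b: "b \<in> o(\<lambda>n. log 2 (real n))"
    and uw: "uses_weights (treewidth_class 4) S w" and w: "w \<in> O(\<lambda>n. real n ^ c)"
  \<comment> \<open>One power more than the weights: \<open>(M / r) ^ r\<close> outgrows every
    multiple of \<open>M ^ c\<close>.\<close>
  define r where "r = Suc c"
  obtain C where C: "C > 0" "eventually (\<lambda>n. norm (w n) \<le> C * norm (real n ^ c)) at_top"
    using landau_o.bigE[OF w] by blast
  \<comment> \<open>The factor \<open>1 / 2\<close> yields at most \<open>sqrt m\<close> weight
    functions.\<close>
  have b': "eventually (\<lambda>n. norm (b n) \<le> 1 / 2 * norm (log 2 (real n))) at_top"
    using landau_o.smallD[OF b, of "1 / 2"] by simp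
  define K where "K = (real r * C * 2 ^ c + 1) * real r ^ r"
  have dbl: "filterlim (\<lambda>M :: nat. 2 * M) at_top at_top"
    by (rule filterlim_at_top_mono[OF filterlim_ident]) simp
  have "eventually (\<lambda>M :: nat. 2 \<le> M \<and> r \<le> M \<and> K < real M \<and> 18 * (r + 1) * 18 * (r + 1) \<le> M) at_top"
    using filterlim_real_sequentially
    by (intro eventually_conj eventually_ge_at_top) (simp add: filterlim_at_top_dense)
  moreover have "eventually (\<lambda>M. norm (w (2 * M)) \<le> C * norm (real (2 * M) ^ c)) at_top"
    using eventually_compose_filterlim[OF C(2) dbl] by simp
  moreover have "eventually (\<lambda>M. norm (b (2 * M)) \<le> 1 / 2 * norm (log 2 (real (2 * M)))) at_top"
    using eventually_compose_filterlim[OF b' dbl] by simp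
  ultimately obtain M :: nat where M: "2 \<le> M" "r \<le> M" "K < real M" "18 * (r + 1) * 18 * (r + 1) \<le> M"
    "norm (w (2 * M)) \<le> C * norm (real (2 * M) ^ c)"
    "norm (b (2 * M)) \<le> 1 / 2 * norm (log 2 (real (2 * M)))"
    using eventually_happens[OF eventually_conj[OF _ eventually_conj]] sequentially_bot by blast
  \<comment> \<open>Half of the \<open>m\<close> numbers feed the pigeonhole argument; the other
    half makes up for those already taken.\<close>
  define m where "m = 2 * M"
  obtain G where G: "G \<in> treewidth_class 4" "card (edges G) = m" "card (verts G) = m"
    using cycle_in_treewidth_class[of m] M(1) by (auto simp: m_def)
  define l where "l = length (S m)"
  have "l > 0" using S by (simp add: l_def HC_isolation_scheme_def)
  have "log 2 (real l) \<le> b m"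
    using ub G unfolding uses_random_bits_def random_bits_def l_def by auto
  also have "\<dots> \<le> 1 / 2 * log 2 (real m)"
    using M(1,6) by (simp add: m_def)
  finally have "log 2 (real l ^ 2) \<le> log 2 (real m)"
    using \<open>l > 0\<close> by (simp add: log_nat_power)
  then have "real l ^ 2 \<le> real m"
    using \<open>l > 0\<close> M(1) by (simp add: m_def)
  then have l2: "l * l \<le> m"
    by (simp only: power2_eq_square of_nat_le_iff flip: of_nat_mult)
  \<comment> \<open>If \<open>l\<close> is small, the choice of \<open>M\<close> suffices; otherwise
    one factor of \<open>l * l \<le> 2 * M\<close> is at least \<open>18 * (r + 1)\<close>. The
    constant 9 serves both size conditions of \<open>HC_isolation_scheme_limit\<close>.\<close>
  have lM: "9 * (r + 1) * l \<le> M"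
  proof (cases "18 * (r + 1) \<le> l")
    case True
    then have "18 * (r + 1) * l \<le> m"
      using l2 mult_le_mono1[OF True, of l] by linarith
    then show ?thesis by (simp add: m_def algebra_simps)
  next
    case False
    then have "9 * (r + 1) * l \<le> 9 * (r + 1) * (18 * (r + 1))"
      by (intro mult_le_mono2) simp
    also have "\<dots> \<le> M" using M(4) by (simp add: algebra_simps)
    finally show ?thesis .
  qed
  have rl: "r \<le> r * l" "1 \<le> l" using \<open>l > 0\<close> by auto
  have lM': "9 * (r * l) + 9 * l \<le> M" using lM by (simp add: algebra_simps)
  have "M choose r \<le> r * max_weight S m + 1"
  proof (rule HC_isolation_scheme_limit[OF S])
    have "2 * r + 4 * (r * l) \<le> M" using lM' rl by linarith
    then have "M + 2 * r + 4 * r * l \<le> m" by (simp add: m_def mult.assoc)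
    then show "M + 2 * r + 4 * r * length (S m) \<le> m" by (simp only: l_def)
    have "4 * ((2 * r + 2) * l + 2) = 8 * (r * l) + 8 * l + 8" by (simp add: algebra_simps)
    also have "\<dots> \<le> m" using lM' rl unfolding m_def by linarith
    finally show "4 * ((2 * r + 2) * length (S m) + 2) \<le> m" by (simp only: l_def)
  qed
  then have "real (M choose r) \<le> real r * real (max_weight S m) + 1"
    by (metis of_nat_1 of_nat_add of_nat_le_iff of_nat_mult)
  also have "real (max_weight S m) \<le> w m"
    using uw G unfolding uses_weights_def by auto
  also have "w m \<le> C * real m ^ c"
    using M(5) by (simp add: m_def)
  also have "real r * (C * real m ^ c) + 1 \<le> (real r * C * 2 ^ c + 1) * real M ^ c"
    using M(1) by (simp add: m_def power_mult_distrib algebra_simps)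
  finally have "real (M choose r) \<le> (real r * C * 2 ^ c + 1) * real M ^ c"
    by (simp add: mult_left_mono)
  moreover have "(real M / real r) ^ r \<le> real (M choose r)"
    using binomial_ge_n_over_k_pow_k[OF M(2)] by simp
  ultimately have "real M ^ r / real r ^ r \<le> (real r * C * 2 ^ c + 1) * real M ^ c"
    unfolding power_divide by (rule order.trans[rotated])
  moreover have "real r ^ r > 0" by (simp add: r_def)
  ultimately have "real M ^ r \<le> K * real M ^ c"
    by (simp add: K_def pos_divide_le_eq mult_ac)
  \<comment> \<open>As \<open>r\<close> is \<open>Suc c\<close>, cancelling \<open>M ^ c\<close>
    leaves a single factor \<open>M\<close>.\<close>
  then have "real M \<le> K"
    using M(1) by (simp add: r_def)
  with M(3) show False by simp
qed

end
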